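(* For every integer $k\ge1$, $\xi_{\mathrm{tr}}(C_{2k+1})=\frac{2k+1}{k}$, where $C_{2k+1}$ is the cycle on $2k+1$ vertices.
   Context: The tracial rank $\xi_{\mathrm{tr}}(G)$ of a graph $G=(V,E)$ is the reciprocal of the supremum of the set of real numbers $u$ for which there exist a unital C*-algebra $\mathcal A$, a tracial state $s$ on $\mathcal A$ (a state with $s(xy)=s(yx)$ for all $x,y\in\mathcal A$) and projections $e_v\in\mathcal A$, $v\in V$, such that $e_ve_w=0$ whenever $(v,w)\in E$ and $s(e_v)=u$ for every $v\in V$. *)

theory Defs
  imports
    "HOL-Analysis.Analysis"
    "HOL-Algebra.Module"
    "Graph_Theory.Pair_Digraph"
begin

section \<open>Unital C*-algebras\<close>

definition complex_field :: "complex ring" where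
  "complex_field = \<lparr>carrier = UNIV, mult = (*), one = 1, zero = 0, add = (+)\<rparr>"

lemma complex_field_cring: "cring complex_field"
proof (rule cringI)
  show "abelian_group complex_field"
    by (rule abelian_groupI) (auto simp: complex_field_def add_eq_0_iff algebra_simps)
  show "comm_monoid complex_field"
    by (rule comm_monoidI) (auto simp: complex_field_def)
qed (auto simp: complex_field_def algebra_simps)

text \<open>
  The algebra is carried by a subset of the type \<open>'a\<close>, so that one can quantify existentially
  over C*-algebras inside a formula.
\<close>

record 'a cstar = "(complex, 'a) module" +
  star :: "'a \<Rightarrow> 'a"
  cnorm :: "'a \<Rightarrow> real"

locale unital_cstar_algebra = Module.module complex_field A + ring A
  for A :: "('a, 'm) cstar_scheme" (structure) +
  assumes smult_mult_left:
      "\<lbrakk>x \<in> carrier A; y \<in> carrier A\<rbrakk> \<Longrightarrow> (c \<odot> x) \<otimes> y = c \<odot> (x \<otimes> y)"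
    and smult_mult_right:
      "\<lbrakk>x \<in> carrier A; y \<in> carrier A\<rbrakk> \<Longrightarrow> x \<otimes> (c \<odot> y) = c \<odot> (x \<otimes> y)"
    and star_closed: "x \<in> carrier A \<Longrightarrow> star A x \<in> carrier A"
    and star_star: "x \<in> carrier A \<Longrightarrow> star A (star A x) = x"
    and star_add:
      "\<lbrakk>x \<in> carrier A; y \<in> carrier A\<rbrakk> \<Longrightarrow> star A (x \<oplus> y) = star A x \<oplus> star A y"
    and star_smult: "x \<in> carrier A \<Longrightarrow> star A (c \<odot> x) = cnj c \<odot> star A x"
    and star_mult:
      "\<lbrakk>x \<in> carrier A; y \<in> carrier A\<rbrakk> \<Longrightarrow> star A (x \<otimes> y) = star A y \<otimes> star A x"
    and cnorm_nonneg: "x \<in> carrier A \<Longrightarrow> 0 \<le> cnorm A x"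
    and cnorm_eq_0_iff: "x \<in> carrier A \<Longrightarrow> cnorm A x = 0 \<longleftrightarrow> x = \<zero>"
    and cnorm_smult: "x \<in> carrier A \<Longrightarrow> cnorm A (c \<odot> x) = cmod c * cnorm A x"
    and cnorm_triangle:
      "\<lbrakk>x \<in> carrier A; y \<in> carrier A\<rbrakk> \<Longrightarrow> cnorm A (x \<oplus> y) \<le> cnorm A x + cnorm A y"
    and cnorm_mult:
      "\<lbrakk>x \<in> carrier A; y \<in> carrier A\<rbrakk> \<Longrightarrow> cnorm A (x \<otimes> y) \<le> cnorm A x * cnorm A y"
    and cnorm_star_mult: "x \<in> carrier A \<Longrightarrow> cnorm A (star A x \<otimes> x) = (cnorm A x)\<^sup>2"
    and complete:
      "\<lbrakk>\<And>n::nat. f n \<in> carrier A;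
        \<And>\<epsilon>. \<epsilon> > 0 \<Longrightarrow> \<exists>N. \<forall>m\<ge>N. \<forall>n\<ge>N. cnorm A (f m \<ominus> f n) < \<epsilon>\<rbrakk>
       \<Longrightarrow> \<exists>x\<in>carrier A. (\<lambda>n. cnorm A (f n \<ominus> x)) \<longlonglongrightarrow> 0"

definition state :: "('a, 'm) cstar_scheme \<Rightarrow> ('a \<Rightarrow> complex) \<Rightarrow> bool" where
  "state A s \<longleftrightarrow>
     (\<forall>x\<in>carrier A. \<forall>y\<in>carrier A. s (x \<oplus>\<^bsub>A\<^esub> y) = s x + s y) \<and>
     (\<forall>c. \<forall>x\<in>carrier A. s (c \<odot>\<^bsub>A\<^esub> x) = c * s x) \<and>
     (\<forall>x\<in>carrier A. s (star A x \<otimes>\<^bsub>A\<^esub> x) \<in> \<real>\<^sub>\<ge>\<^sub>0) \<and>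
     s \<one>\<^bsub>A\<^esub> = 1"

definition tracial_state :: "('a, 'm) cstar_scheme \<Rightarrow> ('a \<Rightarrow> complex) \<Rightarrow> bool" where
  "tracial_state A s \<longleftrightarrow>
     state A s \<and> (\<forall>x\<in>carrier A. \<forall>y\<in>carrier A. s (x \<otimes>\<^bsub>A\<^esub> y) = s (y \<otimes>\<^bsub>A\<^esub> x))"

definition projection :: "('a, 'm) cstar_scheme \<Rightarrow> 'a \<Rightarrow> bool" where
  "projection A e \<longleftrightarrow> e \<in> carrier A \<and> star A e = e \<and> e \<otimes>\<^bsub>A\<^esub> e = e"

section \<open>Tracial rank\<close>

text \<open>
  HOL cannot quantify over all types inside a formula, so ``there exists a C*-algebra'' ranges
  over those carried by subsets of \<open>'a + (nat \<Rightarrow> complex)\<close>. The type \<open>'a\<close> is arbitrary, so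
  every C*-algebra (carried by any type) is covered, up to isomorphism, by some instance.
  The second summand guarantees that the universe always has at least the cardinality of the
  continuum. For a countable graph no instance therefore misses a value: the C*-subalgebra
  generated by the identity and the projections is separable, hence of cardinality at most the
  continuum, and a tracial state restricts to it.
\<close>

definition tracial_values :: "'a itself \<Rightarrow> 'v pair_pre_digraph \<Rightarrow> real set" where
  "tracial_values _ G =
     {u. \<exists>(A :: ('a + (nat \<Rightarrow> complex)) cstar) s e.
           unital_cstar_algebra A \<and> tracial_state A s \<and>
           (\<forall>v\<in>pverts G. projection A (e v)) \<and>
           (\<forall>(v, w)\<in>parcs G. e v \<otimes>\<^bsub>A\<^esub> e w = \<zero>\<^bsub>A\<^esub>) \<and>
           (\<forall>v\<in>pverts G. s (e v) = of_real u)}"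

definition tracial_rank :: "'a itself \<Rightarrow> 'v pair_pre_digraph \<Rightarrow> real" (\<open>\<xi>\<^sub>t\<^sub>r\<close>) where
  "\<xi>\<^sub>t\<^sub>r T G = 1 / Sup (tracial_values T G)"

section \<open>Cycles\<close>

text \<open>An undirected edge is represented by its two orientations.\<close>

definition cycle_graph :: "nat \<Rightarrow> nat pair_pre_digraph" where
  "cycle_graph n =
     \<lparr>pverts = {..<n},
      parcs = {(i, j). i < n \<and> j < n \<and> (j = (i + 1) mod n \<or> i = (j + 1) mod n)}\<rparr>"

lemma pair_graph_cycle_graph:
  assumes "n \<ge> 3"
  shows "pair_graph (cycle_graph n)"
proof
  show "finite (parcs (cycle_graph n))"
    by (rule finite_subset[of _ "{..<n} \<times> {..<n}"]) (auto simp: cycle_graph_def)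
  show "symmetric (with_proj (cycle_graph n))"
    by (auto simp: symmetric_def sym_def cycle_graph_def)
  have "i \<noteq> (i + 1) mod n" if "i < n" for i
    using that assms by (cases "i + 1 = n") auto
  then show "fst e \<noteq> snd e" if "e \<in> parcs (cycle_graph n)" for e
    using that by (fastforce simp: cycle_graph_def)
qed (auto simp: cycle_graph_def)

end

theory Submission
  imports Defs "HOL-Number_Theory.Cong"
begin

text \<open>
  The supremum of the values \<open>u\<close> for the cycle on \<open>2k + 1\<close> vertices is \<open>k / (2k + 1)\<close>, and it is
  attained.

  That \<open>u\<close> cannot be larger is a dimension count. In a von Neumann algebra, write the trace of a
  projection as the dimension of its range. A vector in the range of \<open>e\<^sub>0\<close> that is annihilated by the
  \<open>k\<close> projections \<open>f\<^sub>j = 1 - e\<^bsub>2j+1\<^esub> - e\<^bsub>2j+2\<^esub>\<close>, where \<open>0 \<le> j < k\<close>, lies in the ranges of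
  \<open>e\<^sub>0, e\<^sub>2, \<dots>, e\<^bsub>2k\<^esub>\<close> in turn, and hence is 0, as \<open>e\<^sub>0\<close> and \<open>e\<^bsub>2k\<^esub>\<close> are orthogonal. So the range of
  \<open>e\<^sub>0\<close> embeds into the direct sum of the ranges of the \<open>f\<^sub>j\<close>, which have dimension \<open>1 - 2u\<close>; therefore
  \<open>u \<le> k (1 - 2u)\<close>.

  In a C*-algebra the trace of a projection has no lattice of ranges to lean on, but the embedding
  is bounded below with an explicit constant. This permits a proof of the dimension inequality
  (\<open>trace_projection_le_sum\<close>) from positivity and traciality of the state: the projection onto
  the image of the embedding is approximated by polynomials in the given projections. The chain of
  ranges around the cycle supplies the lower bound (\<open>odd_cycle_trace_sum_le\<close>).

  The value \<open>k / (2k + 1)\<close> comes from a fractional colouring: a uniformly random rotation of an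
  independent set of size \<open>k\<close>, read as commuting projections in the algebra of
  \<open>(2k + 1)\<close>-tuples with the mean as trace (\<open>odd_cycle_tracial_value\<close>).
\<close>

section \<open>The seminorm of a tracial state\<close>

locale tracial_cstar_algebra = unital_cstar_algebra A
  for A :: "('a, 'm) cstar_scheme" (structure) +
  fixes \<tau> :: "'a \<Rightarrow> complex"
  assumes tracial: "tracial_state A \<tau>"
begin

definition tr :: "'a \<Rightarrow> real" where "tr x = Re (\<tau> x)"

text \<open>
  The squared seminorm of the Gelfand--Naimark--Segal construction. Left multiplication by a
  projection is an orthogonal projection for it.
\<close>

definition sqnorm :: "'a \<Rightarrow> real" where "sqnorm x = tr (star A x \<otimes> x)"

declare star_closed [simp] star_star [simp] star_add [simp] star_smult [simp] star_mult [simp]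
  smult_mult_left [simp] smult_mult_right [simp]

lemma scale_closed [simp]: "x \<in> carrier A \<Longrightarrow> c \<odot> x \<in> carrier A"
  using smult_closed[of c x] by (simp add: complex_field_def)

lemma tr_add [simp]: "\<lbrakk>x \<in> carrier A; y \<in> carrier A\<rbrakk> \<Longrightarrow> tr (x \<oplus> y) = tr x + tr y"
  using tracial by (simp add: tr_def tracial_state_def state_def)

lemma tr_scale [simp]: "x \<in> carrier A \<Longrightarrow> tr (complex_of_real r \<odot> x) = r * tr x"
  using tracial by (simp add: tr_def tracial_state_def state_def)

lemma tr_zero [simp]: "tr \<zero> = 0"
  using tr_add[of \<zero> \<zero>] by simp

lemma tr_one [simp]: "tr \<one> = 1"
  using tracial by (simp add: tr_def tracial_state_def state_def)

lemma tr_minus [simp]: "x \<in> carrier A \<Longrightarrow> tr (\<ominus> x) = - tr x"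
  using tr_add[of x "\<ominus> x"] by (simp add: r_neg)

lemma tr_diff [simp]: "\<lbrakk>x \<in> carrier A; y \<in> carrier A\<rbrakk> \<Longrightarrow> tr (x \<ominus> y) = tr x - tr y"
  by (simp add: minus_eq)

lemma tr_finsum:
  assumes "finite I" "f \<in> I \<rightarrow> carrier A"
  shows "tr (\<Oplus>i\<in>I. f i) = (\<Sum>i\<in>I. tr (f i))"
  using assms by (induction I) (auto simp: Pi_def)

lemma tr_commute: "\<lbrakk>x \<in> carrier A; y \<in> carrier A\<rbrakk> \<Longrightarrow> tr (x \<otimes> y) = tr (y \<otimes> x)"
  using tracial by (simp add: tr_def tracial_state_def)

lemma sqnorm_nonneg: "x \<in> carrier A \<Longrightarrow> 0 \<le> sqnorm x"
  using tracial by (auto simp: tr_def sqnorm_def tracial_state_def state_def nonneg_Reals_def complex_nonneg_Reals_iff)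

lemma star_zero [simp]: "star A \<zero> = \<zero>"
proof -
  have "star A \<zero> \<oplus> star A \<zero> = star A \<zero>"
    by (simp flip: star_add)
  then show ?thesis
    by (simp add: add.l_cancel_one)
qed

lemma star_one [simp]: "star A \<one> = \<one>"
proof -
  have "\<one> = star A (\<one> \<otimes> star A \<one>)"
    by (simp del: star_mult)
  also have "\<dots> = star A \<one>" by (subst star_mult) auto
  finally show ?thesis by simp
qed

lemma star_minus [simp]:
  assumes x: "x \<in> carrier A"
  shows "star A (\<ominus> x) = \<ominus> star A x"
proof -
  have "star A (\<ominus> x) \<oplus> star A x = \<zero>"
    using x by (simp add: l_neg flip: star_add)
  then show ?thesis
    using x by (simp add: minus_equality)
qed

lemma star_diff [simp]:
  "\<lbrakk>x \<in> carrier A; y \<in> carrier A\<rbrakk> \<Longrightarrow> star A (x \<ominus> y) = star A x \<ominus> star A y"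
  by (simp add: minus_eq)

lemma star_finsum:
  assumes "finite I" "f \<in> I \<rightarrow> carrier A"
  shows "star A (\<Oplus>i\<in>I. f i) = (\<Oplus>i\<in>I. star A (f i))"
  using assms by (induction I) (auto simp: Pi_def)

lemma sqnorm_diff_scale:
  assumes "x \<in> carrier A" "y \<in> carrier A"
  shows "sqnorm (x \<ominus> complex_of_real c \<odot> y)
         = sqnorm x - c * (tr (star A x \<otimes> y) + tr (star A y \<otimes> x)) + c\<^sup>2 * sqnorm y"
  using assms
  by (simp add: sqnorm_def minus_eq l_distr r_distr l_minus r_minus algebra_simps power2_eq_square)

lemma sqnorm_add:
  assumes "x \<in> carrier A" "y \<in> carrier A"
  shows "sqnorm (x \<oplus> y) = sqnorm x + (tr (star A x \<otimes> y) + tr (star A y \<otimes> x)) + sqnorm y"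
  using assms by (simp add: sqnorm_def l_distr r_distr)

text \<open>
  Positivity of the square of \<open>y - c x\<close>, divided by \<open>c\<close>, bounds the cross terms. The free weight
  \<open>c\<close> lets the inequality be iterated without losing in the constants.
\<close>

lemma sqnorm_add_le:
  assumes xy: "x \<in> carrier A" "y \<in> carrier A" and c: "c > 0"
  shows "sqnorm (x \<oplus> y) \<le> (1 + c) * sqnorm x + (1 + 1 / c) * sqnorm y"
proof -
  let ?X = "tr (star A x \<otimes> y) + tr (star A y \<otimes> x)"
  have "0 \<le> sqnorm (y \<ominus> complex_of_real c \<odot> x)"
    using xy by (intro sqnorm_nonneg) auto
  then have "c * ?X \<le> c\<^sup>2 * sqnorm x + sqnorm y"
    using xy by (simp add: sqnorm_diff_scale algebra_simps)
  then have "?X \<le> c * sqnorm x + sqnorm y / c"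
    using c by (simp add: field_simps power2_eq_square)
  then show ?thesis
    using xy by (simp add: sqnorm_add algebra_simps)
qed

lemma projectionD:
  assumes "projection A e"
  shows "e \<in> carrier A" "star A e = e" "e \<otimes> e = e" "x \<in> carrier A \<Longrightarrow> e \<otimes> (e \<otimes> x) = e \<otimes> x"
  using assms by (auto simp: projection_def simp flip: m_assoc)

lemma sqnorm_projection:
  assumes "projection A e" "x \<in> carrier A"
  shows "sqnorm (e \<otimes> x) = tr (star A x \<otimes> (e \<otimes> x))"
  using assms(2) projectionD[OF assms(1)] by (simp add: sqnorm_def m_assoc)

lemma sqnorm_projection_le:
  assumes "projection A e" "x \<in> carrier A"
  shows "sqnorm (e \<otimes> x) \<le> sqnorm x"
proof -
  have "0 \<le> sqnorm (x \<ominus> e \<otimes> x)"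
    using assms(2) projectionD[OF assms(1)] by (intro sqnorm_nonneg) auto
  then show ?thesis
    using assms(2) projectionD[OF assms(1)] sqnorm_projection[OF assms]
    by (simp add: sqnorm_def minus_eq l_distr r_distr l_minus r_minus m_assoc)
qed

text \<open>
  Adding one more summand to \<open>n\<close> others with the weight \<open>c = n\<close> turns the factor \<open>n\<close> into exactly
  \<open>n + 1\<close>.
\<close>

lemma sqnorm_finsum_le:
  assumes "finite I" "f \<in> I \<rightarrow> carrier A"
  shows "sqnorm (\<Oplus>i\<in>I. f i) \<le> card I * (\<Sum>i\<in>I. sqnorm (f i))"
  using assms
proof (induction I rule: finite_induct)
  case empty
  then show ?case by (simp add: sqnorm_def)
next
  case (insert j J)
  show ?case
  proof (cases "J = {}")
    case True
    then show ?thesis using insert.prems by simp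
  next
    case False
    define n :: real where "n = card J"
    have n: "n > 0"
      using False insert.hyps by (simp add: n_def card_gt_0_iff)
    have f: "f j \<in> carrier A" "f \<in> J \<rightarrow> carrier A"
      using insert.prems by auto
    have "sqnorm (\<Oplus>i\<in>insert j J. f i) = sqnorm (f j \<oplus> (\<Oplus>i\<in>J. f i))"
      using insert.hyps f by simp
    also have "\<dots> \<le> (1 + n) * sqnorm (f j) + (1 + 1 / n) * sqnorm (\<Oplus>i\<in>J. f i)"
      using n f by (intro sqnorm_add_le) auto
    also have "\<dots> \<le> (1 + n) * sqnorm (f j) + (1 + 1 / n) * (n * (\<Sum>i\<in>J. sqnorm (f i)))"
      using n insert.IH[OF f(2)] by (intro add_left_mono mult_left_mono) (auto simp: n_def)
    also have "\<dots> = (1 + n) * (sqnorm (f j) + (\<Sum>i\<in>J. sqnorm (f i)))"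
      using n by (simp add: field_simps)
    finally show ?thesis
      using insert.hyps by (simp add: n_def)
  qed
qed

section \<open>A dimension inequality for projections\<close>

text \<open>
  If the map \<open>x \<mapsto> (f\<^sub>i x)\<^sub>i\<close> is bounded below on the range of \<open>e\<close>, then it should embed that range
  into the direct sum of the ranges of the \<open>f\<^sub>i\<close>, and the trace of \<open>e\<close>, as a dimension, is at most
  the sum of the traces of the \<open>f\<^sub>i\<close>.

  Formally, put \<open>F = \<Sum>\<^sub>i f\<^sub>i\<close> and \<open>y = e F e\<close>. If \<open>h\<close> were an inverse of \<open>y\<close> in the corner
  \<open>e A e\<close>, the matrix \<open>(f\<^sub>i h f\<^sub>j)\<close> would be the projection onto the image of the embedding. The
  inverse is replaced by partial sums \<open>h\<^sub>N\<close> of a Neumann series, so that \<open>y h\<^sub>N = e - z\<^sup>N\<close> with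
  \<open>z = e - y / n\<close>. For self-adjoint \<open>h\<close> in the corner, positivity of the trace on the squares of
  \<open>f\<^sub>j - f\<^sub>j h f\<^sub>j\<close> gives
  \<open>0 \<le> \<Sum>\<^sub>j \<tau>(f\<^sub>j) - 2 \<tau>(y h) + \<tau>(y h y h)\<close>;
  the last term is the sum of the squared seminorms of all entries of the matrix, and so it bounds
  the contribution of the diagonal entries. At \<open>h = h\<^sub>N\<close> the right-hand side is
  \<open>\<Sum>\<^sub>j \<tau>(f\<^sub>j) - \<tau>(e) + \<tau>(z\<^bsup>2N\<^esup>)\<close>. The lower bound on the embedding makes left multiplication by
  \<open>z\<close> a strict contraction on the range of \<open>e\<close>, so the error term tends to 0.
\<close>

lemma trace_projection_le_sum:
  assumes e: "projection A e" and I: "finite I" and f: "\<And>i. i \<in> I \<Longrightarrow> projection A (f i)"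
    and C: "C > 0"
    and bound: "\<And>x. \<lbrakk>x \<in> carrier A; e \<otimes> x = x\<rbrakk> \<Longrightarrow> sqnorm x \<le> C * (\<Sum>i\<in>I. sqnorm (f i \<otimes> x))"
  shows "tr e \<le> (\<Sum>i\<in>I. tr (f i))"
proof -
  \<comment> \<open>The summand 1 keeps \<open>n\<close> nonzero for empty \<open>I\<close>.\<close>
  define n :: real where "n = card I + 1"
  define c :: complex where "c = complex_of_real (1 / n)"
  define F where "F = (\<Oplus>i\<in>I. f i)"
  define y where "y = e \<otimes> (F \<otimes> e)"
  define z where "z = e \<ominus> c \<odot> y"
  have n: "n \<ge> 1" "real (card I) \<le> n" by (auto simp: n_def)
  have fI: "f \<in> I \<rightarrow> carrier A" using projectionD(1)[OF f] by auto
  have [simp]: "e \<in> carrier A" "star A e = e" "e \<otimes> e = e"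
    "\<And>x. x \<in> carrier A \<Longrightarrow> e \<otimes> (e \<otimes> x) = e \<otimes> x"
    using projectionD[OF e] by auto
  have F[simp]: "F \<in> carrier A" "star A F = F"
    using I fI projectionD[OF f] by (auto simp: F_def star_finsum intro!: finsum_cong' finsum_closed)
  have y[simp]: "y \<in> carrier A" "star A y = y" "e \<otimes> y = y" "y \<otimes> e = y"
    by (auto simp: y_def m_assoc)
  have z[simp]: "z \<in> carrier A" "star A z = z" "e \<otimes> z = z" "z \<otimes> e = z"
    by (auto simp: z_def c_def minus_eq l_distr r_distr l_minus r_minus)

  have F_mult: "F \<otimes> x = (\<Oplus>i\<in>I. f i \<otimes> x)" if "x \<in> carrier A" for x
    using that I fI by (simp add: F_def finsum_ldistr)
  \<comment> \<open>Traciality enters here: on the corner of \<open>e\<close> the trace cannot tell \<open>F\<close> from \<open>y = e F e\<close>.\<close>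
  have sum_tr: "(\<Sum>i\<in>I. tr (f i \<otimes> w)) = tr (y \<otimes> w)"
    if w: "w \<in> carrier A" "e \<otimes> w = w" "w \<otimes> e = w" for w
  proof -
    have "tr (y \<otimes> w) = tr (e \<otimes> (F \<otimes> w))"
      using w by (simp add: y_def m_assoc)
    also have "\<dots> = tr (F \<otimes> w)"
      using w by (subst tr_commute) (auto simp: m_assoc)
    also have "\<dots> = (\<Sum>i\<in>I. tr (f i \<otimes> w))"
      using w I fI by (simp add: F_mult tr_finsum Pi_def)
    finally show ?thesis ..
  qed
  have sum_sqnorm: "(\<Sum>i\<in>I. sqnorm (f i \<otimes> x)) = tr (star A x \<otimes> (y \<otimes> x))"
    if x: "x \<in> carrier A" "e \<otimes> x = x" for x
  proof -
    have x': "star A x \<otimes> (e \<otimes> w) = star A x \<otimes> w" if "w \<in> carrier A" for w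
    proof -
      have "star A x \<otimes> e = star A (e \<otimes> x)"
        using x(1) by (subst star_mult) auto
      then show ?thesis using x that by (simp flip: m_assoc)
    qed
    have "(\<Sum>i\<in>I. sqnorm (f i \<otimes> x)) = (\<Sum>i\<in>I. tr (f i \<otimes> (x \<otimes> star A x)))"
      using x f projectionD(1)[OF f] by (intro sum.cong refl)
        (simp add: sqnorm_projection, subst tr_commute, auto simp: m_assoc)
    also have "\<dots> = tr (F \<otimes> (x \<otimes> star A x))"
      using x I fI by (simp add: F_mult tr_finsum Pi_def)
    also have "\<dots> = tr (star A x \<otimes> (F \<otimes> x))"
      using x by (subst (2) tr_commute) (auto simp: m_assoc)
    also have "\<dots> = tr (star A x \<otimes> (y \<otimes> x))"
      using x by (simp add: y_def m_assoc x')
    finally show ?thesis .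
  qed

  \<comment> \<open>
    The factor \<open>1 / n\<close> in \<open>z\<close> works because \<open>y\<^sup>2 \<le> n y\<close>. The maximum makes \<open>q\<close> nonnegative, so that
    its powers may be used as bounds.
  \<close>
  define q where "q = max 0 (1 - 1 / (n * C))"
  have q: "0 \<le> q" "q < 1" using n C by (auto simp: q_def)
  have contract: "sqnorm (z \<otimes> x) \<le> q * sqnorm x" if x: "x \<in> carrier A" "e \<otimes> x = x" for x
  proof -
    define S where "S = (\<Sum>i\<in>I. sqnorm (f i \<otimes> x))"
    have S: "S \<ge> 0" using x fI by (auto simp: S_def intro!: sum_nonneg sqnorm_nonneg)
    have "sqnorm (y \<otimes> x) \<le> sqnorm (F \<otimes> x)"
      using x e by (simp add: y_def m_assoc sqnorm_projection_le)
    also have "\<dots> \<le> card I * S"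
      using x I fI unfolding S_def F_mult[OF x(1)] by (intro sqnorm_finsum_le) auto
    also have "\<dots> \<le> n * S" using n S by (intro mult_right_mono)
    finally have yx: "sqnorm (y \<otimes> x) \<le> n * S" .
    have "z \<otimes> x = x \<ominus> c \<odot> (y \<otimes> x)"
      using x by (simp add: z_def minus_eq l_distr l_minus)
    then have "sqnorm (z \<otimes> x) = sqnorm x - 2 * S / n + sqnorm (y \<otimes> x) / n\<^sup>2"
      using x by (simp add: c_def sqnorm_diff_scale S_def sum_sqnorm m_assoc power_divide del: of_real_divide)
    also have "\<dots> \<le> sqnorm x - 2 * S / n + n * S / n\<^sup>2"
      using yx n by (intro add_left_mono divide_right_mono) auto
    also have "\<dots> = sqnorm x - S / n"
      using n by (simp add: power2_eq_square)
    also have "\<dots> \<le> sqnorm x - sqnorm x / C / n"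
      using bound[OF x] C n by (intro diff_left_mono divide_right_mono) (auto simp: S_def field_simps)
    also have "\<dots> = (1 - 1 / (n * C)) * sqnorm x"
      by (simp add: field_simps)
    also have "\<dots> \<le> q * sqnorm x"
      using x by (intro mult_right_mono sqnorm_nonneg) (auto simp: q_def)
    finally show ?thesis .
  qed

  \<comment> \<open>\<open>p N\<close> is the \<open>N\<close>-th power of \<open>z\<close> in the corner, whose unit is \<open>e\<close>.\<close>
  define p where "p N = ((\<otimes>) z ^^ N) e" for N
  have p_0: "p 0 = e" and p_Suc: "p (Suc N) = z \<otimes> p N" for N
    by (simp_all add: p_def)
  have p[simp]: "p N \<in> carrier A" "e \<otimes> p N = p N" "p N \<otimes> e = p N" for N
    by (induction N) (simp_all add: p_0 p_Suc m_assoc, simp flip: m_assoc)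
  have p_z: "p N \<otimes> z = z \<otimes> p N" for N
    by (induction N) (simp_all add: p_0 p_Suc m_assoc)
  have star_p[simp]: "star A (p N) = p N" for N
    by (induction N) (simp_all add: p_0 p_Suc p_z)
  have sqnorm_p: "sqnorm (p N) \<le> q ^ N * sqnorm e" for N
  proof (induction N)
    case (Suc N)
    have "sqnorm (p (Suc N)) \<le> q * sqnorm (p N)"
      unfolding p_Suc by (intro contract) auto
    also have "\<dots> \<le> q * (q ^ N * sqnorm e)"
      using Suc q by (intro mult_left_mono)
    finally show ?case by simp
  qed (simp add: p_0)

  define h where "h N = (\<Oplus>m\<in>{..<N}. c \<odot> p m)" for N
  have h_0: "h 0 = \<zero>" and h_Suc: "h (Suc N) = c \<odot> p N \<oplus> h N" for N
    by (simp_all add: h_def lessThan_Suc)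
  have h[simp]: "h N \<in> carrier A" "star A (h N) = h N" "e \<otimes> h N = h N" "h N \<otimes> e = h N" for N
    by (induction N) (simp_all add: h_0 h_Suc l_distr r_distr c_def)
  have y_h: "y \<otimes> h N = e \<ominus> p N" for N
  proof (induction N)
    case (Suc N)
    have "p (Suc N) = p N \<ominus> c \<odot> (y \<otimes> p N)"
      by (simp add: p_Suc z_def minus_eq l_distr l_minus)
    moreover have "y \<otimes> h (Suc N) = c \<odot> (y \<otimes> p N) \<oplus> (e \<ominus> p N)"
      by (simp add: h_Suc r_distr Suc)
    moreover have "\<And>a b d. \<lbrakk>a \<in> carrier A; b \<in> carrier A; d \<in> carrier A\<rbrakk> \<Longrightarrow> d \<oplus> (a \<ominus> b) = a \<ominus> (b \<ominus> d)"
      by algebra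
    ultimately show ?case by simp
  qed (simp add: h_0 p_0 minus_eq r_neg)

  have "tr e \<le> (\<Sum>i\<in>I. tr (f i)) + q ^ N * sqnorm e" for N
  proof -
    let ?H = "h N"
    have "0 \<le> tr (f j) - 2 * tr (f j \<otimes> ?H) + tr (f j \<otimes> (?H \<otimes> (y \<otimes> ?H)))" if j: "j \<in> I" for j
    proof -
      note fj = f[OF j] projectionD[OF f[OF j]]
      let ?g = "f j \<otimes> (?H \<otimes> f j)"
      have g: "tr ?g = tr (f j \<otimes> ?H)"
        using fj by (subst tr_commute) (auto simp: m_assoc intro: tr_commute)
      \<comment> \<open>the diagonal entry is one of the entries of its column\<close>
      have "sqnorm ?g \<le> (\<Sum>i\<in>I. sqnorm (f i \<otimes> (?H \<otimes> f j)))"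
        using I j fI fj by (intro member_le_sum) (auto intro!: sqnorm_nonneg)
      also have "\<dots> = tr (star A (?H \<otimes> f j) \<otimes> (y \<otimes> (?H \<otimes> f j)))"
        using fj by (intro sum_sqnorm) (auto simp flip: m_assoc)
      also have "\<dots> = tr ((f j \<otimes> (?H \<otimes> (y \<otimes> ?H))) \<otimes> f j)"
        using fj by (simp add: m_assoc)
      also have "\<dots> = tr (f j \<otimes> (?H \<otimes> (y \<otimes> ?H)))"
        using fj by (subst tr_commute) auto
      finally have *: "sqnorm ?g \<le> tr (f j \<otimes> (?H \<otimes> (y \<otimes> ?H)))" .
      have "0 \<le> sqnorm (f j \<ominus> complex_of_real 1 \<odot> ?g)"
        using fj by (intro sqnorm_nonneg) auto
      also have "\<dots> = sqnorm (f j) - (tr ?g + tr ?g) + sqnorm ?g"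
        using fj by (subst sqnorm_diff_scale) (auto simp: m_assoc simp del: of_real_1)
      also have "sqnorm (f j) = tr (f j)" using fj by (simp add: sqnorm_def)
      finally show ?thesis using * g by simp
    qed
    then have "0 \<le> (\<Sum>j\<in>I. tr (f j) - 2 * tr (f j \<otimes> ?H) + tr (f j \<otimes> (?H \<otimes> (y \<otimes> ?H))))"
      by (intro sum_nonneg)
    also have "\<dots> = (\<Sum>j\<in>I. tr (f j)) - 2 * tr (y \<otimes> ?H) + tr (y \<otimes> (?H \<otimes> (y \<otimes> ?H)))"
      by (simp add: sum.distrib sum_subtractf sum_tr m_assoc flip: sum_distrib_left)
         (subst sum_tr, auto simp: m_assoc simp flip: m_assoc[of e])
    also have "y \<otimes> (?H \<otimes> (y \<otimes> ?H)) = (e \<ominus> p N) \<otimes> (e \<ominus> p N)"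
      by (simp add: m_assoc flip: y_h)
    also have "tr (y \<otimes> ?H) = tr e - tr (p N)"
      by (simp add: y_h)
    also have "tr ((e \<ominus> p N) \<otimes> (e \<ominus> p N)) = tr e - 2 * tr (p N) + sqnorm (p N)"
      by (simp add: sqnorm_def minus_eq l_distr r_distr l_minus r_minus)
    finally show ?thesis using sqnorm_p[of N] by simp
  qed
  moreover have "(\<lambda>N. (\<Sum>i\<in>I. tr (f i)) + q ^ N * sqnorm e) \<longlonglongrightarrow> (\<Sum>i\<in>I. tr (f i)) + 0 * sqnorm e"
    using q by (intro tendsto_intros LIMSEQ_realpow_zero)
  ultimately show ?thesis
    by (intro LIMSEQ_le_const[of "\<lambda>N. (\<Sum>i\<in>I. tr (f i)) + q ^ N * sqnorm e"]) auto
qed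

section \<open>The upper bound for odd cycles\<close>

lemma projection_complement_sum:
  assumes "projection A a" "projection A b" "a \<otimes> b = \<zero>" "b \<otimes> a = \<zero>"
  shows "projection A (\<one> \<ominus> a \<ominus> b)"
proof -
  note ab = projectionD[OF assms(1)] projectionD[OF assms(2)] assms(3,4)
  have "(\<one> \<ominus> a \<ominus> b) \<otimes> (\<one> \<ominus> a \<ominus> b) = \<one> \<ominus> a \<ominus> b"
    using ab by (simp add: minus_eq l_distr r_distr l_minus r_minus l_neg r_neg a_assoc)
  moreover have "star A (\<one> \<ominus> a \<ominus> b) = \<one> \<ominus> a \<ominus> b"
    using ab by simp
  moreover have "\<one> \<ominus> a \<ominus> b \<in> carrier A"
    using ab by simp
  ultimately show ?thesis
    unfolding projection_def by blast
qed

lemma orthogonal_sym: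
  assumes "projection A a" "projection A b" "a \<otimes> b = \<zero>"
  shows "b \<otimes> a = \<zero>"
proof -
  note ab = projectionD[OF assms(1)] projectionD[OF assms(2)]
  have "star A (a \<otimes> b) = b \<otimes> a" using ab by (subst star_mult) auto
  then show ?thesis using assms by simp
qed

text \<open>
  Pair up the vertices other than 0 into the edges \<open>{2j + 1, 2j + 2}\<close> and let \<open>f\<^sub>j\<close> be the
  projection complementary to \<open>e\<^bsub>2j+1\<^esub> + e\<^bsub>2j+2\<^esub>\<close>. If \<open>x\<close> in the range of \<open>e\<^sub>0\<close> is killed by all \<open>f\<^sub>j\<close>,
  then \<open>e\<^bsub>2j\<^esub> x = x\<close> propagates along the path: it forces \<open>e\<^bsub>2j+1\<^esub> x = 0\<close>, hence \<open>e\<^bsub>2j+2\<^esub> x = x\<close>.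
  At the end \<open>x = e\<^sub>0 x = e\<^sub>0 e\<^bsub>2k\<^esub> x = 0\<close>, by the closing edge. So the \<open>f\<^sub>j\<close> are jointly injective on
  the range of \<open>e\<^sub>0\<close>; with \<open>r\<^sub>j = x - e\<^bsub>2j\<^esub> x\<close> as the error after \<open>j\<close> steps, the same argument yields
  the lower bound that the dimension inequality asks for. That inequality is then
  \<open>\<tau>(e\<^sub>0) \<le> k - \<Sum>\<^bsub>v \<ge> 1\<^esub> \<tau>(e\<^sub>v)\<close>.
\<close>

lemma odd_cycle_trace_sum_le:
  assumes e: "\<And>v. v \<le> 2 * k \<Longrightarrow> projection A (e v)"
    and adj: "\<And>v. v < 2 * k \<Longrightarrow> e v \<otimes> e (Suc v) = \<zero>"
    and closing: "e 0 \<otimes> e (2 * k) = \<zero>"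
    and k: "k \<ge> 1"
  shows "(\<Sum>v\<le>2 * k. tr (e v)) \<le> k"
proof -
  define f where "f j = \<one> \<ominus> e (2 * j + 1) \<ominus> e (2 * j + 2)" for j
  note [simp] = projectionD[OF e]
  have adj': "e (Suc v) \<otimes> e v = \<zero>" if "v < 2 * k" for v
    using that by (intro orthogonal_sym[of "e v"] e adj) auto
  have f: "projection A (f j)" if "j < k" for j
    unfolding f_def using that adj[of "2 * j + 1"] adj'[of "2 * j + 1"]
    by (intro projection_complement_sum e) auto
  have "tr (e 0) \<le> (\<Sum>j<k. tr (f j))"
  proof (rule trace_projection_le_sum[where C = "real k"])
    fix x assume x: "x \<in> carrier A" "e 0 \<otimes> x = x"
    define r where "r j = x \<ominus> e (2 * j) \<otimes> x" for j
    have r[simp]: "r j \<in> carrier A" if "j \<le> k" for j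
      using x that by (simp add: r_def)
    have r_0: "r 0 = \<zero>" using x by (simp add: r_def r_neg minus_eq)
    \<comment> \<open>
      Since \<open>e\<^bsub>2j+1\<^esub> e\<^bsub>2j\<^esub> = 0\<close>, the vectors \<open>x\<close> and \<open>r\<^sub>j\<close> have the same image under \<open>e\<^bsub>2j+1\<^esub>\<close>.
    \<close>
    have r_Suc: "r (Suc j) = f j \<otimes> x \<oplus> e (2 * j + 1) \<otimes> r j" if "j < k" for j
    proof -
      have "e (2 * j + 1) \<otimes> (e (2 * j) \<otimes> x) = \<zero>"
        using that x adj'[of "2 * j"] by (simp flip: m_assoc)
      then have "e (2 * j + 1) \<otimes> r j = e (2 * j + 1) \<otimes> x"
        using that x by (simp add: r_def minus_eq r_distr r_minus)
      moreover have "f j \<otimes> x = x \<ominus> e (2 * j + 1) \<otimes> x \<ominus> e (2 * j + 2) \<otimes> x"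
        using that x by (simp add: f_def minus_eq l_distr l_minus)
      moreover have "a \<ominus> b \<ominus> d \<oplus> b = a \<ominus> d"
        if "a \<in> carrier A" "b \<in> carrier A" "d \<in> carrier A" for a b d
        using that by algebra
      ultimately show ?thesis
        using that x by (simp add: r_def)
    qed
    have "sqnorm (r j) \<le> j * (\<Sum>i<j. sqnorm (f i \<otimes> x))" if "j \<le> k" for j
      using that
    proof (induction j)
      case 0
      then show ?case by (simp add: r_0 sqnorm_def)
    next
      case (Suc j)
      \<comment> \<open>The weight in the triangle inequality is \<open>j\<close>, which has to be positive.\<close>
      show ?case
      proof (cases "j = 0")
        case True
        then show ?thesis
          using r_Suc[of 0] Suc.prems x projectionD(1)[OF f[of 0]] by (simp add: r_0)
      next
        case False
        have cl: "f j \<otimes> x \<in> carrier A" "e (2 * j + 1) \<otimes> r j \<in> carrier A"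
          using Suc.prems x projectionD(1)[OF f[of j]] by auto
        have "sqnorm (r (Suc j)) \<le> (1 + real j) * sqnorm (f j \<otimes> x) + (1 + 1 / real j) * sqnorm (e (2 * j + 1) \<otimes> r j)"
          using Suc.prems False cl r_Suc[of j] by (simp only:) (intro sqnorm_add_le, auto)
        also have "\<dots> \<le> (1 + real j) * sqnorm (f j \<otimes> x) + (1 + 1 / real j) * (j * (\<Sum>i<j. sqnorm (f i \<otimes> x)))"
          using Suc by (intro add_left_mono mult_left_mono order.trans[OF sqnorm_projection_le]) (auto intro!: e)
        also have "\<dots> = Suc j * (\<Sum>i<Suc j. sqnorm (f i \<otimes> x))"
          using False by (simp add: field_simps)
        finally show ?thesis .
      qed
    qed
    then have "sqnorm (r k) \<le> k * (\<Sum>i<k. sqnorm (f i \<otimes> x))" by simp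
    moreover have "e 0 \<otimes> r k = x"
    proof -
      have "e 0 \<otimes> (e (2 * k) \<otimes> x) = \<zero>"
        using x closing by (simp flip: m_assoc)
      then show ?thesis
        using x by (simp add: r_def minus_eq r_distr r_minus)
    qed
    then have "sqnorm x \<le> sqnorm (r k)"
      using sqnorm_projection_le[OF e[of 0], of "r k"] by simp
    ultimately show "sqnorm x \<le> k * (\<Sum>i<k. sqnorm (f i \<otimes> x))" by simp
  qed (use e[of 0] f k in auto)
  also have "\<dots> = (\<Sum>j<k. 1 - tr (e (2 * j + 1)) - tr (e (2 * j + 2)))"
    by (intro sum.cong) (auto simp: f_def)
  also have "\<dots> = k - (\<Sum>v\<in>{1..2 * k}. tr (e v))"
    by (induction k) (auto simp: algebra_simps)
  finally show ?thesis
    by (simp add: atMost_atLeast0 sum.atLeast_Suc_atMost)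
qed

end

section \<open>The lower bound for odd cycles\<close>

text \<open>
  The commutative C*-algebra of complex \<open>n\<close>-tuples. A tuple is a function that vanishes from \<open>n\<close> on,
  injected into the sum type that carries the algebras in question; the function \<open>embed n\<close>
  truncates, so that the coordinates below \<open>n\<close> determine an element.
\<close>

definition coord :: "'a + (nat \<Rightarrow> complex) \<Rightarrow> nat \<Rightarrow> complex" where
  "coord x = projr x"

definition embed :: "nat \<Rightarrow> (nat \<Rightarrow> complex) \<Rightarrow> 'a + (nat \<Rightarrow> complex)" where
  "embed n g = Inr (\<lambda>i. if i < n then g i else 0)"

lemma coord_embed [simp]: "i < n \<Longrightarrow> coord (embed n g) i = g i"
  by (simp add: coord_def embed_def)

lemma embed_eq_iff: "embed n g = embed n h \<longleftrightarrow> (\<forall>i<n. g i = h i)"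
  by (auto simp: embed_def fun_eq_iff)

definition diagonal_algebra :: "nat \<Rightarrow> ('a + (nat \<Rightarrow> complex)) cstar" where
  "diagonal_algebra n =
     \<lparr>carrier = range (embed n),
      mult = \<lambda>x y. embed n (\<lambda>i. coord x i * coord y i),
      one = embed n (\<lambda>_. 1),
      zero = embed n (\<lambda>_. 0),
      add = \<lambda>x y. embed n (\<lambda>i. coord x i + coord y i),
      smult = \<lambda>c x. embed n (\<lambda>i. c * coord x i),
      star = \<lambda>x. embed n (\<lambda>i. cnj (coord x i)),
      cnorm = \<lambda>x. Max ((\<lambda>i. cmod (coord x i)) ` {..<n})\<rparr>"

definition mean :: "nat \<Rightarrow> 'a + (nat \<Rightarrow> complex) \<Rightarrow> complex" where
  "mean n x = (\<Sum>i<n. coord x i) / of_nat n"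

lemma ring_diagonal_algebra: "ring (diagonal_algebra n :: ('a + (nat \<Rightarrow> complex)) cstar)"
proof -
  let ?A = "diagonal_algebra n :: ('a + (nat \<Rightarrow> complex)) cstar"
  have "\<exists>y\<in>carrier ?A. y \<oplus>\<^bsub>?A\<^esub> x = \<zero>\<^bsub>?A\<^esub>" if x: "x \<in> carrier ?A" for x
  proof -
    obtain g where "x = embed n g" using x by (auto simp: diagonal_algebra_def)
    then show ?thesis
      by (intro bexI[of _ "embed n (\<lambda>i. - g i)"]) (auto simp: diagonal_algebra_def embed_eq_iff)
  qed
  then have "abelian_group ?A"
    by (intro abelian_groupI) (auto simp: diagonal_algebra_def embed_eq_iff algebra_simps)
  moreover have "Group.monoid ?A"
    by (rule monoidI) (auto simp: diagonal_algebra_def embed_eq_iff algebra_simps)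
  ultimately show ?thesis
    by (intro ringI) (auto simp: diagonal_algebra_def embed_eq_iff algebra_simps)
qed

lemma diagonal_algebra_minus:
  assumes "x \<in> carrier (diagonal_algebra n)" "y \<in> carrier (diagonal_algebra n)"
  shows "x \<ominus>\<^bsub>diagonal_algebra n\<^esub> y = embed n (\<lambda>i. coord x i - coord y i)"
proof -
  interpret ring "diagonal_algebra n" by (rule ring_diagonal_algebra)
  obtain h where h: "y = embed n h" using assms by (auto simp: diagonal_algebra_def)
  have "\<ominus>\<^bsub>diagonal_algebra n\<^esub> y = embed n (\<lambda>i. - coord y i)"
    using assms by (intro minus_equality) (auto simp: diagonal_algebra_def embed_eq_iff)
  then show ?thesis
    unfolding minus_eq by (auto simp: diagonal_algebra_def embed_eq_iff)
qed

lemma unital_cstar_algebra_diagonal_algebra: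
  assumes n: "n > 0"
  shows "unital_cstar_algebra (diagonal_algebra n :: ('a + (nat \<Rightarrow> complex)) cstar)"
proof -
  let ?A = "diagonal_algebra n :: ('a + (nat \<Rightarrow> complex)) cstar"
  interpret ring ?A by (rule ring_diagonal_algebra)
  have norm_le: "cnorm ?A x \<le> b \<longleftrightarrow> (\<forall>i<n. cmod (coord x i) \<le> b)" for x b
    using n by (subst (1) diagonal_algebra_def) (auto simp: Max_le_iff lessThan_empty_iff)
  have coord_le: "cmod (coord x i) \<le> cnorm ?A x" if "i < n" for x i
    using norm_le[of x "cnorm ?A x"] that by simp
  have norm_attained: "\<exists>i<n. cnorm ?A x = cmod (coord x i)" for x
  proof -
    have "Max ((\<lambda>i. cmod (coord x i)) ` {..<n}) \<in> (\<lambda>i. cmod (coord x i)) ` {..<n}"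
      using n by (intro Max_in) (auto simp: lessThan_empty_iff)
    then show ?thesis
      by (simp only: diagonal_algebra_def cstar.simps) auto
  qed
  have norm_ge_0: "0 \<le> cnorm ?A x" for x
    using norm_attained[of x] by auto
  have norm_eqI: "cnorm ?A x = b" if "\<And>i. i < n \<Longrightarrow> cmod (coord x i) \<le> b" "i < n" "cmod (coord x i) = b" for x i b
    using that coord_le[of i x] norm_le[of x b] by force
  have smult: "c \<odot>\<^bsub>?A\<^esub> x = embed n (\<lambda>i. c * coord x i)"
    and mult: "x \<otimes>\<^bsub>?A\<^esub> y = embed n (\<lambda>i. coord x i * coord y i)"
    and add: "x \<oplus>\<^bsub>?A\<^esub> y = embed n (\<lambda>i. coord x i + coord y i)"
    and star: "star ?A x = embed n (\<lambda>i. cnj (coord x i))"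
    and zero: "\<zero>\<^bsub>?A\<^esub> = embed n (\<lambda>_. 0)"
    and carrier: "carrier ?A = range (embed n)" for c x y
    by (simp_all add: diagonal_algebra_def)
  note ops = smult mult add star zero carrier
  have "Module.module complex_field ?A"
    by (intro moduleI complex_field_cring abelian_group_axioms)
      (auto simp: ops complex_field_def embed_eq_iff algebra_simps)
  then interpret Module.module complex_field ?A .
  show ?thesis
  proof unfold_locales
    fix x assume x: "x \<in> carrier ?A"
    show "cnorm ?A x = 0 \<longleftrightarrow> x = \<zero>\<^bsub>?A\<^esub>"
      using x norm_le[of x 0] norm_ge_0[of x] by (auto simp: ops embed_eq_iff)
    fix c
    obtain i where i: "i < n" "cnorm ?A x = cmod (coord x i)"
      using norm_attained by blast
    show "cnorm ?A (c \<odot>\<^bsub>?A\<^esub> x) = cmod c * cnorm ?A x"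
      using i coord_le[of _ x] by (intro norm_eqI[of _ _ i]) (auto simp: ops norm_mult intro!: mult_left_mono)
    show "cnorm ?A (star ?A x \<otimes>\<^bsub>?A\<^esub> x) = (cnorm ?A x)\<^sup>2"
      using i coord_le[of _ x]
      by (intro norm_eqI[of _ _ i]) (auto simp: ops norm_mult power2_eq_square intro!: mult_mono)
  next
    fix x y
    show "cnorm ?A (x \<oplus>\<^bsub>?A\<^esub> y) \<le> cnorm ?A x + cnorm ?A y"
      unfolding norm_le using coord_le
      by (auto simp: ops intro!: order.trans[OF norm_triangle_ineq] add_mono)
    show "cnorm ?A (x \<otimes>\<^bsub>?A\<^esub> y) \<le> cnorm ?A x * cnorm ?A y"
      unfolding norm_le using coord_le norm_ge_0
      by (auto simp: ops norm_mult intro!: mult_mono)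
  next
    fix f :: "nat \<Rightarrow> _"
    assume f: "\<And>m. f m \<in> carrier ?A"
      and Cauchy: "\<And>\<epsilon>. \<epsilon> > 0 \<Longrightarrow> \<exists>N. \<forall>m\<ge>N. \<forall>l\<ge>N. cnorm ?A (f m \<ominus>\<^bsub>?A\<^esub> f l) < \<epsilon>"
    have "convergent (\<lambda>m. coord (f m) i)" if i: "i < n" for i
    proof -
      have "cmod (coord (f m) i - coord (f l) i) \<le> cnorm ?A (f m \<ominus>\<^bsub>?A\<^esub> f l)" for m l
        using coord_le[OF i, of "f m \<ominus>\<^bsub>?A\<^esub> f l"] i by (simp add: diagonal_algebra_minus f)
      then have "Cauchy (\<lambda>m. coord (f m) i)"
        using Cauchy unfolding Cauchy_def dist_norm by (meson order.strict_trans1)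
      then show ?thesis
        by (rule Cauchy_convergent)
    qed
    then have "\<forall>i. \<exists>l. i < n \<longrightarrow> (\<lambda>m. coord (f m) i) \<longlonglongrightarrow> l"
      unfolding convergent_def by blast
    then obtain g where g: "\<And>i. i < n \<Longrightarrow> (\<lambda>m. coord (f m) i) \<longlonglongrightarrow> g i"
      by metis
    have "(\<lambda>m. \<Sum>i<n. cmod (coord (f m) i - g i)) \<longlonglongrightarrow> (\<Sum>i<n. cmod (g i - g i))"
      by (intro tendsto_intros g) auto
    then have "(\<lambda>m. \<Sum>i<n. cmod (coord (f m) i - g i)) \<longlonglongrightarrow> 0"
      by simp
    moreover have "cnorm ?A (f m \<ominus>\<^bsub>?A\<^esub> embed n g) \<le> (\<Sum>i<n. cmod (coord (f m) i - g i))" for m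
      unfolding norm_le
    proof (intro allI impI)
      fix i assume i: "i < n"
      have "f m \<ominus>\<^bsub>?A\<^esub> embed n g = embed n (\<lambda>i. coord (f m) i - coord (embed n g :: 'a + (nat \<Rightarrow> complex)) i)"
        using f by (intro diagonal_algebra_minus) (auto simp: carrier)
      then have "coord (f m \<ominus>\<^bsub>?A\<^esub> embed n g) i = coord (f m) i - g i"
        using i by simp
      then show "cmod (coord (f m \<ominus>\<^bsub>?A\<^esub> embed n g) i) \<le> (\<Sum>i<n. cmod (coord (f m) i - g i))"
        using i by (auto intro!: member_le_sum[of i "{..<n}" "\<lambda>i. cmod (coord (f m) i - g i)"])
    qed
    ultimately have "(\<lambda>m. cnorm ?A (f m \<ominus>\<^bsub>?A\<^esub> embed n g)) \<longlonglongrightarrow> 0"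
      by (rule tendsto_sandwich[OF always_eventually[OF allI, OF norm_ge_0]
            always_eventually[OF allI] tendsto_const, rotated])
    then show "\<exists>x\<in>carrier ?A. (\<lambda>m. cnorm ?A (f m \<ominus>\<^bsub>?A\<^esub> x)) \<longlonglongrightarrow> 0"
      by (auto simp: carrier)
  qed (auto simp: ops embed_eq_iff norm_ge_0 algebra_simps)
qed

lemma tracial_state_mean:
  assumes n: "n > 0"
  shows "tracial_state (diagonal_algebra n) (mean n)"
proof -
  have "(\<Sum>i<n. cnj (g i) * g i) / of_nat n \<in> \<real>\<^sub>\<ge>\<^sub>0" for g :: "nat \<Rightarrow> complex"
  proof -
    have "(\<Sum>i<n. cnj (g i) * g i) / of_nat n = complex_of_real ((\<Sum>i<n. (cmod (g i))\<^sup>2) / n)"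
      by (simp add: complex_norm_square mult.commute del: of_real_power)
    then show ?thesis
      by (simp only: nonneg_Reals_of_real_iff) (intro divide_nonneg_nonneg sum_nonneg, auto)
  qed
  then show ?thesis
    using n by (auto simp: tracial_state_def state_def diagonal_algebra_def mean_def sum.distrib
        add_divide_distrib sum_distrib_left mult.commute)
qed

text \<open>
  Let coordinate \<open>i\<close> see the independent set \<open>{0, 2, \<dots>, 2k - 2}\<close> rotated by \<open>-i\<close>, and let
  \<open>e\<^sub>v\<close> be the indicator of the rotations that contain \<open>v\<close>. Adjacent vertices never lie in a common
  rotation, and each vertex lies in exactly \<open>k\<close> of the \<open>2k + 1\<close> rotations.
\<close>

lemma odd_cycle_tracial_value:
  "real k / real (2 * k + 1) \<in> tracial_values TYPE('a) (cycle_graph (2 * k + 1))"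
proof -
  define n where "n = 2 * k + 1"
  have n: "n > 0" by (simp add: n_def)
  define P where "P j \<longleftrightarrow> even j \<and> j < 2 * k" for j
  let ?A = "diagonal_algebra n :: ('a + (nat \<Rightarrow> complex)) cstar"
  define e :: "nat \<Rightarrow> 'a + (nat \<Rightarrow> complex)"
    where "e v = embed n (\<lambda>i. if P ((i + v) mod n) then 1 else 0)" for v
  have independent: "\<not> (P ((i + v) mod n) \<and> P ((i + (v + 1) mod n) mod n))" for i v
  proof -
    have "(i + (v + 1) mod n) mod n = Suc (i + v) mod n"
      by (simp add: mod_simps)
    also have "\<dots> = (if Suc ((i + v) mod n) = n then 0 else Suc ((i + v) mod n))"
      by (rule mod_Suc)
    finally show ?thesis by (auto simp: P_def n_def)
  qed
  have orth: "e v \<otimes>\<^bsub>?A\<^esub> e w = \<zero>\<^bsub>?A\<^esub>" if "w = (v + 1) mod n \<or> v = (w + 1) mod n" for v w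
    using that independent[of _ v] independent[of _ w]
    by (auto simp: diagonal_algebra_def e_def embed_eq_iff)
  have "mean n (e v) = complex_of_real (k / n)" for v
  proof -
    have inj: "inj_on (\<lambda>i. (i + v) mod n) {..<n}"
    proof (rule inj_onI)
      fix i j assume "i \<in> {..<n}" "j \<in> {..<n}" "(i + v) mod n = (j + v) mod n"
      then show "i = j"
        using cong_add_rcancel_nat[of i v j n] by (auto simp: cong_def)
    qed
    have "bij_betw (\<lambda>i. (i + v) mod n) {..<n} {..<n}"
      using n by (intro bij_betw_imageI inj endo_inj_surj) (auto intro: inj)
    then have "(\<Sum>i<n. if P ((i + v) mod n) then 1 else 0 :: complex) = (\<Sum>j<n. if P j then 1 else 0)"
      by (rule sum.reindex_bij_betw)
    also have "\<dots> = of_nat (card {j\<in>{..<n}. P j})"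
      by (simp add: sum.If_cases Int_def)
    also have "{j\<in>{..<n}. P j} = (*) 2 ` {..<k}"
      by (auto simp: P_def n_def elim!: evenE)
    also have "card \<dots> = k"
      by (simp add: card_image inj_on_def)
    finally show ?thesis
      by (simp add: mean_def e_def)
  qed
  moreover have "projection ?A (e v)" for v
    by (auto simp: projection_def diagonal_algebra_def e_def embed_eq_iff)
  ultimately show ?thesis
    using unital_cstar_algebra_diagonal_algebra[OF n] tracial_state_mean[OF n] orth
    unfolding tracial_values_def n_def[symmetric]
    by (intro CollectI exI[of _ ?A] exI[of _ "mean n"] exI[of _ e]) (auto simp: cycle_graph_def)
qed

section \<open>The tracial rank of odd cycles\<close>

theorem theorem7p4:
  fixes k :: nat
  assumes "k \<ge> 1"
  shows "tracial_rank TYPE('a) (cycle_graph (2 * k + 1)) = real (2 * k + 1) / real k"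
proof -
  let ?V = "tracial_values TYPE('a) (cycle_graph (2 * k + 1))"
  have "u \<le> real k / real (2 * k + 1)" if u: "u \<in> ?V" for u
  proof -
    obtain A :: "('a + (nat \<Rightarrow> complex)) cstar" and s e where
      A: "unital_cstar_algebra A" and s: "tracial_state A s"
      and e: "\<forall>v\<in>pverts (cycle_graph (2 * k + 1)). projection A (e v)"
      and orth: "\<forall>(v, w)\<in>parcs (cycle_graph (2 * k + 1)). e v \<otimes>\<^bsub>A\<^esub> e w = \<zero>\<^bsub>A\<^esub>"
      and val: "\<forall>v\<in>pverts (cycle_graph (2 * k + 1)). s (e v) = of_real u"
      using u unfolding tracial_values_def by blast
    interpret tracial_cstar_algebra A s
      using A s by (simp add: tracial_cstar_algebra_def tracial_cstar_algebra_axioms_def)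
    have "(\<Sum>v\<le>2 * k. tr (e v)) \<le> k"
    proof (rule odd_cycle_trace_sum_le)
      show "e v \<otimes>\<^bsub>A\<^esub> e (Suc v) = \<zero>\<^bsub>A\<^esub>" if "v < 2 * k" for v
        using that orth by (auto simp: cycle_graph_def)
      show "e 0 \<otimes>\<^bsub>A\<^esub> e (2 * k) = \<zero>\<^bsub>A\<^esub>"
        using orth by (auto simp: cycle_graph_def)
    qed (use e assms in \<open>auto simp: cycle_graph_def\<close>)
    also have "(\<Sum>v\<le>2 * k. tr (e v)) = (\<Sum>v\<le>2 * k. u)"
      using val by (intro sum.cong) (auto simp: tr_def cycle_graph_def)
    finally show ?thesis
      by (simp add: field_simps)
  qed
  then have "Sup ?V = real k / real (2 * k + 1)"
    using odd_cycle_tracial_value[of k] by (intro cSup_eq_maximum) auto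
  then show ?thesis
    by (simp add: tracial_rank_def)
qed

end
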